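(* Let $S=\sum_{i=1}^N2s_i$ and let $Q^+(z)=\prod_{i=1}^S\frac{z-u_i}{c}$ and $Q^-(z)=\prod_{i=1}^S\frac{z-v_i}{c}$ (with $u_i,v_i\in\mathbb{C}$) be two Baxter Q-polynomials corresponding to the same eigenvalue $\Lambda(z)$ of the transfer matrix, i.e. satisfying the two inhomogeneous Baxter T-Q equations $$\Lambda(z)Q^+(z)=(\tilde\kappa-\rho_1)\lambda_1(z)Q^+(z-c)+(\kappa-\rho_2)\lambda_2(z)Q^+(z+c)+(\rho_1+\rho_2)F(z),$$ $$\Lambda(z)Q^-(z)=(\kappa-\rho_2)\lambda_1(z)Q^-(z-c)+(\tilde\kappa-\rho_1)\lambda_2(z)Q^-(z+c)+(\rho_1+\rho_2)F(z)$$ with the same function $\Lambda(z)$. Then $Q^\pm$ are related by the modified quantum Wronskian equation (as an identity of rational functions in $z$) $$W(z)-W(z+c)=(\rho_1+\rho_2)\big(Q^+(z)-Q^-(z)\big),$$ where $$W(z)=\frac{(\tilde\kappa-\rho_1)Q^+(z-c)Q^-(z)-(\kappa-\rho_2)Q^+(z)Q^-(z-c)}{\lambda(z)}.$$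
   Context: Fix a nonzero constant $c\in\mathbb{C}$, an integer $N\ge1$, spins $s_1,\dots,s_N\in\{\tfrac12,1,\tfrac32,\dots\}$ and inhomogeneity parameters $\theta_1,\dots,\theta_N\in\mathbb{C}$. Define $$\lambda_1(z)=\prod_{i=1}^N\frac{z-\theta_i+c(s_i+\frac12)}{c},\qquad \lambda_2(z)=\prod_{i=1}^N\frac{z-\theta_i-c(s_i-\frac12)}{c},$$ $$\lambda(z)=\prod_{i=1}^N\prod_{k=1}^{2s_i}\frac{z-\theta_i+c(s_i-k+\frac12)}{c},\qquad F(z)=\prod_{i=1}^N\prod_{k=0}^{2s_i}\frac{z-\theta_i+c(s_i-k+\frac12)}{c}.$$ The parameters $\tilde\kappa,\kappa,\kappa^+,\kappa^-\in\mathbb{C}$, with $\kappa^\pm\neq0$, are the entries of the twist matrix $\begin{pmatrix}\tilde\kappa&\kappa^+\\\kappa^-&\kappa\end{pmatrix}$, and $\rho_1,\rho_2\in\mathbb{C}$ satisfy $\kappa^+\kappa^--(\rho_1\kappa+\rho_2\tilde\kappa)+\rho_1\rho_2=0$ and $\rho_1\rho_2\ne\kappa^+\kappa^-$. The two T-Q equations are those characterizing the eigenvalues $\Lambda(z)$ of the twisted transfer matrix $t(z)=\tilde\kappa t_{11}(z)+\kappa t_{22}(z)+\kappa^+t_{21}(z)+\kappa^-t_{12}(z)$ of the XXX spin chain with spins $s_i$; the transfer matrix enters the statement only through these two equations. *)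

theory Defs
  imports Complex_Main
begin

definition spins :: "real set" where
  "spins = {real m / 2 | m. m \<ge> 1}"

text \<open>The natural number $2s$ for a spin $s$; the floor is exact for $s$ in \<^const>\<open>spins\<close>.\<close>
definition twice :: "real \<Rightarrow> nat" where
  "twice s = nat \<lfloor>2 * s\<rfloor>"

definition lambda1 :: "complex \<Rightarrow> nat \<Rightarrow> (nat \<Rightarrow> real) \<Rightarrow> (nat \<Rightarrow> complex) \<Rightarrow> complex \<Rightarrow> complex" where
  "lambda1 c N s \<theta> z = (\<Prod>i=1..N. (z - \<theta> i + c * (of_real (s i) + 1/2)) / c)"

definition lambda2 :: "complex \<Rightarrow> nat \<Rightarrow> (nat \<Rightarrow> real) \<Rightarrow> (nat \<Rightarrow> complex) \<Rightarrow> complex \<Rightarrow> complex" where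
  "lambda2 c N s \<theta> z = (\<Prod>i=1..N. (z - \<theta> i - c * (of_real (s i) - 1/2)) / c)"

definition lambda :: "complex \<Rightarrow> nat \<Rightarrow> (nat \<Rightarrow> real) \<Rightarrow> (nat \<Rightarrow> complex) \<Rightarrow> complex \<Rightarrow> complex" where
  "lambda c N s \<theta> z =
     (\<Prod>i=1..N. \<Prod>k=1..twice (s i). (z - \<theta> i + c * (of_real (s i) - of_nat k + 1/2)) / c)"

definition F :: "complex \<Rightarrow> nat \<Rightarrow> (nat \<Rightarrow> real) \<Rightarrow> (nat \<Rightarrow> complex) \<Rightarrow> complex \<Rightarrow> complex" where
  "F c N s \<theta> z =
     (\<Prod>i=1..N. \<Prod>k=0..twice (s i). (z - \<theta> i + c * (of_real (s i) - of_nat k + 1/2)) / c)"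

text \<open>The Baxter Q-polynomial of degree $S$ with roots $u_1,\dots,u_S$.\<close>
definition Qpoly :: "complex \<Rightarrow> nat \<Rightarrow> (nat \<Rightarrow> complex) \<Rightarrow> complex \<Rightarrow> complex" where
  "Qpoly c S u z = (\<Prod>i=1..S. (z - u i) / c)"

text \<open>The function $W$, with \<open>a\<close> $= \tilde\kappa-\rho_1$ and \<open>b\<close> $= \kappa-\rho_2$.  Since division
  by zero is total here, its value is meaningful only where \<^const>\<open>lambda\<close> does not vanish.\<close>
definition W ::
  "complex \<Rightarrow> nat \<Rightarrow> (nat \<Rightarrow> real) \<Rightarrow> (nat \<Rightarrow> complex) \<Rightarrow> complex \<Rightarrow> complex \<Rightarrow>
   (complex \<Rightarrow> complex) \<Rightarrow> (complex \<Rightarrow> complex) \<Rightarrow> complex \<Rightarrow> complex" where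
  "W c N s \<theta> a b Qp Qm z =
     (a * Qp (z - c) * Qm z - b * Qp z * Qm (z - c)) / lambda c N s \<theta> z"

end

theory Submission
  imports Defs
begin

text \<open>Eliminating \<open>\<Lambda>\<close> from the two T-Q equations and using the factorizations
  \<open>\<lambda>\<^sub>1(z) \<lambda>(z) = F(z) = \<lambda>\<^sub>2(z) \<lambda>(z + c)\<close> gives the Wronskian equation multiplied by \<open>F(z)\<close>.
  Dividing by \<open>F(z)\<close> settles all but finitely many points; the zeros of \<open>F\<close> are reached by
  continuity, after clearing the denominators \<open>\<lambda>(z) \<lambda>(z + c)\<close>.\<close>

lemma of_nat_twice:
  assumes "s \<in> spins"
  shows "of_nat (twice s) = 2 * (of_real s :: complex)"
proof -
  obtain m :: nat where s: "s = real m / 2"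
    using assms by (auto simp: spins_def)
  then have "2 * s = of_int (int m)"
    by simp
  then have "twice s = m"
    unfolding twice_def by (simp only: floor_of_int nat_int)
  then show ?thesis
    unfolding s by simp
qed

text \<open>At each site the factor \<open>k = 0\<close> of \<open>F\<close> is the factor of
  \<open>lambda1\<close>; the factors with \<open>k\<close> from 1 on make up
  \<open>lambda\<close>.\<close>

lemma F_eq_lambda1_lambda: "F c N s \<theta> z = lambda1 c N s \<theta> z * lambda c N s \<theta> z"
proof -
  have split: "(\<Prod>k=0..n. f k) = f 0 * (\<Prod>k=1..n. f k)" for n :: nat and f :: "nat \<Rightarrow> complex"
    by (simp add: prod.atLeast_Suc_atMost)
  show ?thesis
    unfolding F_def lambda1_def lambda_def split prod.distrib by simp
qed

text \<open>Here the last factor, \<open>k = 2s\<close>, is split off at each site. The remaining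
  ones, with \<open>k\<close> from 0 to \<open>2s - 1\<close>, are those of \<open>lambda\<close>
  moved by one step \<open>c\<close>.\<close>

lemma F_eq_lambda2_lambda_shift:
  assumes "\<And>i. i \<in> {1..N} \<Longrightarrow> s i \<in> spins"
  shows "F c N s \<theta> z = lambda2 c N s \<theta> z * lambda c N s \<theta> (z + c)"
  unfolding F_def lambda2_def lambda_def prod.distrib [symmetric]
proof (rule prod.cong [OF refl])
  fix i assume i: "i \<in> {1..N}"
  define f where "f = (\<lambda>k. (z - \<theta> i + c * (of_real (s i) - of_nat k + 1/2)) / c)"
  obtain n where n: "twice (s i) = n" by blast
  have tw: "of_nat n = 2 * (of_real (s i) :: complex)"
    using of_nat_twice [OF assms [OF i]] n by simp
  have "(\<Prod>k=0..n. f k) = (\<Prod>k<n. f k) * f n"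
    by (simp add: atLeast0AtMost lessThan_Suc_atMost [symmetric])
  \<comment> \<open>Half-integrality of the spin enters here: \<open>n = 2s\<close> turns
    \<open>s - n + 1/2\<close> into \<open>-(s - 1/2)\<close>.\<close>
  also have "f n = (z - \<theta> i - c * (of_real (s i) - 1/2)) / c"
    unfolding f_def tw by (simp add: algebra_simps)
  also have "(\<Prod>k<n. f k) = (\<Prod>k=1..n. f (k - 1))"
    by (simp add: prod.atLeast1_atMost_eq)
  also have "\<dots> = (\<Prod>k=1..n. (z + c - \<theta> i + c * (of_real (s i) - of_nat k + 1/2)) / c)"
    by (rule prod.cong) (auto simp: f_def of_nat_diff algebra_simps)
  finally show "(\<Prod>k=0..twice (s i). (z - \<theta> i + c * (of_real (s i) - of_nat k + 1/2)) / c) =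
      (z - \<theta> i - c * (of_real (s i) - 1/2)) / c *
      (\<Prod>k=1..twice (s i). (z + c - \<theta> i + c * (of_real (s i) - of_nat k + 1/2)) / c)"
    unfolding n f_def by (simp add: mult.commute)
qed

text \<open>\<open>F\<close> is a finite product of linear factors with a single zero each, so a
  small enough punctured neighbourhood of any point avoids all zeros.\<close>

lemma eventually_F_nonzero:
  assumes "c \<noteq> 0"
  shows "\<forall>\<^sub>F w in at z. F c N s \<theta> w \<noteq> 0"
proof -
  have "\<forall>\<^sub>F w in at z. (w - \<theta> i + c * (of_real (s i) - of_nat k + 1/2)) / c \<noteq> 0" for i k
    using eventually_neq_at_within
      [of "\<theta> i - c * (of_real (s i) - of_nat k + 1/2)" z UNIV]
    by eventually_elim (use assms in \<open>auto simp: algebra_simps\<close>)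
  then have "\<forall>\<^sub>F w in at z. \<forall>i\<in>{1..N}. \<forall>k\<in>{0..twice (s i)}.
      (w - \<theta> i + c * (of_real (s i) - of_nat k + 1/2)) / c \<noteq> 0"
    by (intro eventually_ball_finite ballI) auto
  then show ?thesis
    unfolding F_def by eventually_elim (simp add: prod_zero_iff)
qed

lemma continuous_on_lambda: "c \<noteq> 0 \<Longrightarrow> continuous_on A (lambda c N s \<theta>)"
  unfolding lambda_def by (intro continuous_intros) auto

lemma continuous_on_Qpoly: "c \<noteq> 0 \<Longrightarrow> continuous_on A (Qpoly c S u)"
  unfolding Qpoly_def by (intro continuous_intros) auto

theorem theorem4p10:
  fixes c :: complex and N :: nat
    and s :: "nat \<Rightarrow> real" and \<theta> :: "nat \<Rightarrow> complex"
    and \<kappa>t \<kappa> \<kappa>p \<kappa>m \<rho>1 \<rho>2 :: complex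
    and S :: nat and u v :: "nat \<Rightarrow> complex"
    and Qp Qm \<Lambda> :: "complex \<Rightarrow> complex"
  assumes "c \<noteq> 0" and "N \<ge> 1"
    and "\<And>i. i \<in> {1..N} \<Longrightarrow> s i \<in> spins"
    and "\<kappa>p \<noteq> 0" and "\<kappa>m \<noteq> 0"
    and "\<kappa>p * \<kappa>m - (\<rho>1 * \<kappa> + \<rho>2 * \<kappa>t) + \<rho>1 * \<rho>2 = 0"
    and "\<rho>1 * \<rho>2 \<noteq> \<kappa>p * \<kappa>m"
    and "S = (\<Sum>i=1..N. twice (s i))"
    and "Qp = Qpoly c S u" and "Qm = Qpoly c S v"
    and "\<And>z. \<Lambda> z * Qp z =
           (\<kappa>t - \<rho>1) * lambda1 c N s \<theta> z * Qp (z - c)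
           + (\<kappa> - \<rho>2) * lambda2 c N s \<theta> z * Qp (z + c)
           + (\<rho>1 + \<rho>2) * F c N s \<theta> z"
    and "\<And>z. \<Lambda> z * Qm z =
           (\<kappa> - \<rho>2) * lambda1 c N s \<theta> z * Qm (z - c)
           + (\<kappa>t - \<rho>1) * lambda2 c N s \<theta> z * Qm (z + c)
           + (\<rho>1 + \<rho>2) * F c N s \<theta> z"
  shows "\<forall>z. lambda c N s \<theta> z \<noteq> 0 \<and> lambda c N s \<theta> (z + c) \<noteq> 0 \<longrightarrow>
           W c N s \<theta> (\<kappa>t - \<rho>1) (\<kappa> - \<rho>2) Qp Qm z
           - W c N s \<theta> (\<kappa>t - \<rho>1) (\<kappa> - \<rho>2) Qp Qm (z + c)
         = (\<rho>1 + \<rho>2) * (Qp z - Qm z)"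
proof (intro allI impI)
  fix z
  assume nz: "lambda c N s \<theta> z \<noteq> 0 \<and> lambda c N s \<theta> (z + c) \<noteq> 0"
  define a b where "a = \<kappa>t - \<rho>1" and "b = \<kappa> - \<rho>2"
  define L where "L = lambda c N s \<theta>"
  define n where "n = (\<lambda>w. a * Qp (w - c) * Qm w - b * Qp w * Qm (w - c))"
  \<comment> \<open>\<open>G\<close> is the difference of the two sides of the Wronskian equation
    times \<open>L w * L (w + c)\<close>, written without division so that it is continuous
    everywhere; \<open>n\<close> is the numerator of \<open>W\<close>.\<close>
  define G where "G = (\<lambda>w. n w * L (w + c) - n (w + c) * L w
    - (\<rho>1 + \<rho>2) * (Qp w - Qm w) * (L w * L (w + c)))"
  have G_eq_0: "G w = 0" if "F c N s \<theta> w \<noteq> 0" for w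
  proof -
    define l1 l2 f where "l1 = lambda1 c N s \<theta> w" and "l2 = lambda2 c N s \<theta> w"
      and "f = F c N s \<theta> w"
    have f1: "f = l1 * L w" and f2: "f = l2 * L (w + c)"
      unfolding f_def l1_def l2_def L_def
      by (fact F_eq_lambda1_lambda) (rule F_eq_lambda2_lambda_shift, fact assms(3))
    \<comment> \<open>Both sides equal \<open>\<Lambda> w * Qp w * Qm w\<close>.\<close>
    have "(a * l1 * Qp (w - c) + b * l2 * Qp (w + c) + (\<rho>1 + \<rho>2) * f) * Qm w =
        (b * l1 * Qm (w - c) + a * l2 * Qm (w + c) + (\<rho>1 + \<rho>2) * f) * Qp w"
      using assms(11) [of w] assms(12) [of w]
      unfolding a_def b_def l1_def l2_def f_def by (metis mult.assoc mult.commute)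
    \<comment> \<open>The \<open>l1\<close> terms combine to \<open>n w\<close>, and the
      \<open>l2\<close> terms to \<open>- n (w + c)\<close>, since
      \<open>(w + c) - c = w\<close>.\<close>
    then have "l1 * n w - l2 * n (w + c) = (\<rho>1 + \<rho>2) * f * (Qp w - Qm w)"
      unfolding n_def by (simp add: algebra_simps)
    \<comment> \<open>In \<open>f * G w\<close> the factor \<open>f\<close> becomes
      \<open>l1 * L w\<close> next to \<open>n w\<close> and \<open>l2 * L (w + c)\<close> next to
      \<open>n (w + c)\<close>, so that \<open>L w * L (w + c)\<close> comes out of every
      term.\<close>
    moreover have "f * G w = L w * L (w + c) * (l1 * n w - l2 * n (w + c)
        - (\<rho>1 + \<rho>2) * f * (Qp w - Qm w))"
      unfolding G_def using f1 f2 by algebra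
    ultimately show "G w = 0"
      using that by (simp add: f_def)
  qed
  have cont: "isCont L w" "isCont Qp w" "isCont Qm w" for w
    using continuous_on_lambda [OF assms(1), of UNIV] continuous_on_Qpoly [OF assms(1), of UNIV]
    by (auto simp: L_def assms(9,10) continuous_on_eq_continuous_at)
  \<comment> \<open>\<open>G_eq_0\<close> says nothing at a zero of \<open>F\<close>, but it covers
    a punctured neighbourhood of \<open>z\<close>; continuity then forces
    \<open>G z = 0\<close>.\<close>
  have "isCont G z"
    unfolding G_def n_def
    by (intro continuous_intros isCont_o2 [OF _ cont(1)] isCont_o2 [OF _ cont(2)]
        isCont_o2 [OF _ cont(3)])
  moreover have "G \<midarrow>z\<rightarrow> 0"
    using eventually_F_nonzero [OF assms(1), of N s \<theta> z]
    by (intro tendsto_eventually) (auto elim: eventually_mono intro: G_eq_0)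
  ultimately have "G z = 0"
    unfolding isCont_def by (rule LIM_unique)
  \<comment> \<open>Only this division by \<open>L z * L (z + c)\<close> needs both values of
    \<open>lambda\<close> to be nonzero.\<close>
  then have "n z / L z - n (z + c) / L (z + c) = (\<rho>1 + \<rho>2) * (Qp z - Qm z)"
    using nz unfolding L_def [symmetric] by (simp add: G_def divide_simps)
  then show "W c N s \<theta> (\<kappa>t - \<rho>1) (\<kappa> - \<rho>2) Qp Qm z
      - W c N s \<theta> (\<kappa>t - \<rho>1) (\<kappa> - \<rho>2) Qp Qm (z + c) = (\<rho>1 + \<rho>2) * (Qp z - Qm z)"
    by (simp add: W_def n_def L_def a_def b_def)
qed

end
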